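(* Let $(X,f)$ be a sensitive topological dynamical system, where $X$ is a (nonempty) compact metric space with metric $d$ and $f:X\to X$ is continuous. Then $$\mathbb{L}_d \le 2\,\overline{\mathbb{L}}_r .$$
   Context: A topological dynamical system $(X,f)$ is a nonempty compact metric space $(X,d)$ together with a continuous map $f:X\to X$ (not assumed invertible or surjective). It is called sensitive if there exists $\varepsilon>0$ such that for every $x\in X$ and every neighborhood $U_x$ of $x$ there exist $y\in U_x$ and an integer $n\ge 0$ with $d(f^n(x),f^n(y))>\varepsilon$. "Opene" means open and nonempty. Two of the Lyapunov numbers of $(X,f)$ are defined as follows (suprema are over real numbers $\varepsilon$): $$\mathbb{L}_d=\sup\{\varepsilon:\ \text{in any opene } U\subset X \text{ there exist } x,y\in U \text{ and a positive integer } n \text{ with } d(f^n(x),f^n(y))>\varepsilon\},$$ $$\overline{\mathbb{L}}_r=\sup\{\varepsilon:\ \text{for every } x\in X \text{ and every open neighborhood } U_x \text{ of } x \text{ there exists } y\in U_x \text{ with } \limsup_{n\to\infty} d(f^n(x),f^n(y))>\varepsilon\}.$$ *)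

theory Defs
  imports "HOL-Analysis.Analysis"
begin

text \<open>
  The space is a subset \<open>X\<close> of an ambient metric space, with the induced metric and topology.
  Open subsets of \<open>X\<close> are therefore the relatively open ones, \<open>openin (top_of_set X)\<close>.
\<close>

definition tds :: "'a::metric_space set \<Rightarrow> ('a \<Rightarrow> 'a) \<Rightarrow> bool" where
  "tds X f \<longleftrightarrow> X \<noteq> {} \<and> compact X \<and> continuous_on X f \<and> f ` X \<subseteq> X"

text \<open>Neighbourhoods in the definition of sensitivity need not be open.\<close>

definition sensitive :: "'a::metric_space set \<Rightarrow> ('a \<Rightarrow> 'a) \<Rightarrow> bool" where
  "sensitive X f \<longleftrightarrow>
     (\<exists>\<epsilon>>0. \<forall>x\<in>X. \<forall>U\<subseteq>X. x \<in> (top_of_set X) interior_of U \<longrightarrow>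
        (\<exists>y\<in>U. \<exists>n. dist ((f ^^ n) x) ((f ^^ n) y) > \<epsilon>))"

definition Ld_set :: "'a::metric_space set \<Rightarrow> ('a \<Rightarrow> 'a) \<Rightarrow> real set" where
  "Ld_set X f =
     {\<epsilon>. \<forall>U. openin (top_of_set X) U \<and> U \<noteq> {} \<longrightarrow>
        (\<exists>x\<in>U. \<exists>y\<in>U. \<exists>n>0. dist ((f ^^ n) x) ((f ^^ n) y) > \<epsilon>)}"

definition Lr_set :: "'a::metric_space set \<Rightarrow> ('a \<Rightarrow> 'a) \<Rightarrow> real set" where
  "Lr_set X f =
     {\<epsilon>. \<forall>x\<in>X. \<forall>U. openin (top_of_set X) U \<and> x \<in> U \<longrightarrow>
        (\<exists>y\<in>U. limsup (\<lambda>n. ereal (dist ((f ^^ n) x) ((f ^^ n) y))) > ereal \<epsilon>)}"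

text \<open>
  As \<open>\<epsilon>\<close> ranges over all reals, both sets contain every negative number; for a compact system
  they are also bounded above (lemmas below), so these real suprema are genuine.
\<close>

definition Ld :: "'a::metric_space set \<Rightarrow> ('a \<Rightarrow> 'a) \<Rightarrow> real" where
  "Ld X f = Sup (Ld_set X f)"

definition Lr_sup :: "'a::metric_space set \<Rightarrow> ('a \<Rightarrow> 'a) \<Rightarrow> real" where
  "Lr_sup X f = Sup (Lr_set X f)"

lemma tds_funpow: "tds X f \<Longrightarrow> x \<in> X \<Longrightarrow> (f ^^ n) x \<in> X"
  by (induction n) (auto simp: tds_def)

lemma Ld_set_neg:
  assumes "\<epsilon> < 0" shows "\<epsilon> \<in> Ld_set X f"
proof -
  have "\<epsilon> < dist ((f ^^ 1) x) ((f ^^ 1) x)" for x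
    using assms by simp
  then show ?thesis
    unfolding Ld_set_def using zero_less_one by blast
qed

lemma Lr_set_neg:
  assumes "\<epsilon> < 0" shows "\<epsilon> \<in> Lr_set X f"
proof -
  have "ereal \<epsilon> < limsup (\<lambda>n. ereal (dist ((f ^^ n) x) ((f ^^ n) x)))" for x
    using assms by (simp add: Limsup_const zero_ereal_def)
  then show ?thesis unfolding Lr_set_def by blast
qed

lemma Ld_set_bdd_above:
  assumes "tds X f" shows "bdd_above (Ld_set X f)"
proof (rule bdd_aboveI)
  fix \<epsilon> assume "\<epsilon> \<in> Ld_set X f"
  moreover have "openin (top_of_set X) X" "X \<noteq> {}"
    using assms by (auto simp: tds_def)
  ultimately obtain x y n where "x \<in> X" "y \<in> X" "dist ((f ^^ n) x) ((f ^^ n) y) > \<epsilon>"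
    unfolding Ld_set_def by blast
  moreover from this have "dist ((f ^^ n) x) ((f ^^ n) y) \<le> diameter X"
    using assms by (intro diameter_bounded_bound) (auto simp: tds_funpow tds_def compact_imp_bounded)
  ultimately show "\<epsilon> \<le> diameter X" by linarith
qed

lemma Lr_set_bdd_above:
  assumes "tds X f" shows "bdd_above (Lr_set X f)"
proof (rule bdd_aboveI)
  fix \<epsilon> assume e: "\<epsilon> \<in> Lr_set X f"
  obtain x where x: "x \<in> X" using assms by (auto simp: tds_def)
  moreover have "openin (top_of_set X) X" by simp
  ultimately obtain y where y: "y \<in> X"
    "limsup (\<lambda>n. ereal (dist ((f ^^ n) x) ((f ^^ n) y))) > ereal \<epsilon>"
    using e unfolding Lr_set_def by blast
  have "dist ((f ^^ n) x) ((f ^^ n) y) \<le> diameter X" for n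
    using assms x y by (intro diameter_bounded_bound) (auto simp: tds_funpow tds_def compact_imp_bounded)
  then have "limsup (\<lambda>n. ereal (dist ((f ^^ n) x) ((f ^^ n) y))) \<le> ereal (diameter X)"
    by (intro Limsup_bounded) auto
  with y have "ereal \<epsilon> < ereal (diameter X)" by (meson less_le_trans)
  then show "\<epsilon> \<le> diameter X" by simp
qed

end

theory Submission
  imports Defs
begin

text \<open>
  If \<open>\<delta>\<close> does not belong to the set defining \<open>Lr_sup\<close>, then some orbit is followed, with asymptotic
  error at most \<open>\<delta>\<close>, by every orbit that starts in a certain nonempty open set \<open>U\<close>. The time after
  which the error stays below a slightly larger \<open>\<gamma>\<close> depends on the starting point, but Baire's theorem
  makes it uniform: the closed sets of points that follow within \<open>\<gamma>\<close> from time \<open>N\<close> on cover \<open>U\<close>, so one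
  of them has nonempty interior \<open>V\<close> (\<open>uniform_shadowing_time\<close>). By the triangle inequality through the
  followed orbit, \<open>f ^^ n\<close> maps \<open>V\<close> to a set of diameter at most \<open>2 * \<gamma>\<close> for all \<open>n \<ge> N\<close>; this is
  where the factor 2 comes from. The finitely many earlier times are controlled by shrinking
  \<open>V\<close> (\<open>open_subset_small_images\<close>). Hence no \<open>\<epsilon> > 2 * \<gamma>\<close> lies in the set defining \<open>Ld\<close>.
  Contrapositively, every positive \<open>\<epsilon>\<close> in the latter set puts all numbers below \<open>\<epsilon> / 2\<close> into the
  former.
\<close>

lemma tds_continuous_on_funpow:
  assumes "tds X f"
  shows "continuous_on X (f ^^ n)"
proof (induction n)
  case (Suc n)
  have "(f ^^ n) ` X \<subseteq> X"
    using tds_funpow[OF assms] by blast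
  then have "continuous_on ((f ^^ n) ` X) f"
    using assms continuous_on_subset by (auto simp: tds_def)
  then show ?case
    using Suc continuous_on_compose by auto
qed (simp add: id_def)

lemma tds_continuous_on_dist_funpow:
  assumes "tds X f"
  shows "continuous_on X (\<lambda>y. dist a ((f ^^ n) y))"
  by (intro continuous_intros tds_continuous_on_funpow assms)

text \<open>
  A compact metric space is a Baire space, so countably many closed sets with empty interior cannot
  cover the nonempty open set \<open>U\<close>. The nonempty interior obtained need not meet \<open>U\<close>: when \<open>C N\<close> is
  defined by a condition on all points of \<open>X\<close>, only this condition is wanted on an open set.
\<close>

lemma Baire_compact_closed_cover:
  fixes X :: "'a::metric_space set" and C :: "nat \<Rightarrow> 'a set"
  assumes "compact X" and "openin (top_of_set X) U" and "U \<noteq> {}"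
    and "\<And>N. closedin (top_of_set X) (C N)" and "U \<subseteq> (\<Union>N. C N)"
  obtains N where "(top_of_set X) interior_of (C N) \<noteq> {}"
proof (rule ccontr)
  assume "\<not> thesis"
  with that have "\<And>N. (top_of_set X) interior_of (C N) = {}"
    by blast
  moreover have "locally_compact_space (top_of_set X) \<and> regular_space (top_of_set X)"
    using assms(1)
    by (simp add: compact_imp_locally_compact_space compact_space_subtopology
        regular_space_subtopology regular_space_euclidean)
  ultimately have "(top_of_set X) interior_of \<Union> (range C) = {}"
    using assms(4) by (intro Baire_category_alt) auto
  moreover have "U \<subseteq> (top_of_set X) interior_of \<Union> (range C)"
    using assms(2,5) by (intro interior_of_maximal) auto
  ultimately show False
    using assms(3) by blast
qed

lemma uniform_shadowing_time:
  assumes "tds X f" and "openin (top_of_set X) U" and "U \<noteq> {}"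
    and limsup: "\<And>y. y \<in> U \<Longrightarrow>
      limsup (\<lambda>n. ereal (dist ((f ^^ n) x) ((f ^^ n) y))) \<le> ereal \<delta>"
    and "\<delta> < \<gamma>"
  obtains V N where "openin (top_of_set X) V" "V \<noteq> {}"
    "\<And>y n. y \<in> V \<Longrightarrow> N \<le> n \<Longrightarrow> dist ((f ^^ n) x) ((f ^^ n) y) \<le> \<gamma>"
proof -
  define C where "C N = {y \<in> X. \<forall>n\<ge>N. dist ((f ^^ n) x) ((f ^^ n) y) \<le> \<gamma>}" for N
  have closed: "closedin (top_of_set X) (C N)" for N
  proof -
    have "C N = (\<Inter>n\<in>{N..}. {y \<in> X. dist ((f ^^ n) x) ((f ^^ n) y) \<in> {..\<gamma>}})"
      by (auto simp: C_def)
    moreover have "closedin (top_of_set X) {y \<in> X. dist ((f ^^ n) x) ((f ^^ n) y) \<in> {..\<gamma>}}" for n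
      using continuous_closedin_preimage[OF tds_continuous_on_dist_funpow[OF assms(1)] closed_atMost]
      by (simp add: vimage_def Int_def)
    ultimately show ?thesis
      by (auto intro!: closedin_INT)
  qed
  have "U \<subseteq> (\<Union>N. C N)"
  proof
    fix y assume y: "y \<in> U"
    have "limsup (\<lambda>n. ereal (dist ((f ^^ n) x) ((f ^^ n) y))) < ereal \<gamma>"
      using limsup[OF y] \<open>\<delta> < \<gamma>\<close> by (meson ereal_less_eq(3) le_less_trans less_ereal.simps(1))
    then have "\<forall>\<^sub>F n in sequentially. ereal (dist ((f ^^ n) x) ((f ^^ n) y)) < ereal \<gamma>"
      by (rule Limsup_lessD)
    then obtain N where "\<And>n. N \<le> n \<Longrightarrow> dist ((f ^^ n) x) ((f ^^ n) y) < \<gamma>"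
      by (auto simp: eventually_sequentially)
    then show "y \<in> (\<Union>N. C N)"
      using y openin_imp_subset[OF assms(2)] by (auto simp: C_def intro!: less_imp_le)
  qed
  then obtain N where N: "(top_of_set X) interior_of (C N) \<noteq> {}"
    using Baire_compact_closed_cover[of X U C] assms closed by (auto simp: tds_def)
  show thesis
  proof (rule that[OF openin_interior_of N])
    fix y n assume "y \<in> (top_of_set X) interior_of (C N)" "N \<le> n"
    then show "dist ((f ^^ n) x) ((f ^^ n) y) \<le> \<gamma>"
      using interior_of_subset[of "top_of_set X" "C N"] by (auto simp: C_def)
  qed
qed

text \<open>
  Only finitely many iterates are constrained, so continuity of each of them at a single point of
  \<open>V\<close> is enough.
\<close>

lemma open_subset_small_images:
  assumes "tds X f" and "openin (top_of_set X) V" and "V \<noteq> {}" and "0 < \<epsilon>"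
  obtains W where "openin (top_of_set X) W" "W \<noteq> {}" "W \<subseteq> V"
    "\<And>y z n. y \<in> W \<Longrightarrow> z \<in> W \<Longrightarrow> n < N \<Longrightarrow> dist ((f ^^ n) y) ((f ^^ n) z) < \<epsilon>"
proof -
  obtain v where v: "v \<in> V"
    using assms(3) by blast
  define B where "B n = {y \<in> X. dist ((f ^^ n) v) ((f ^^ n) y) \<in> {..<\<epsilon>/2}}" for n :: nat
  have VX: "V \<subseteq> X"
    using openin_imp_subset[OF assms(2)] .
  have B: "openin (top_of_set X) (B n)" for n
    unfolding B_def
    using continuous_openin_preimage_gen[OF tds_continuous_on_dist_funpow[OF assms(1)] open_lessThan]
    by (simp only: vimage_def Int_def mem_Collect_eq)
  have "openin (top_of_set X) (((\<Inter>n\<in>{..<N}. B n) \<inter> X) \<inter> V)"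
    by (rule openin_Int[OF _ assms(2)])
      (use openin_INT[of "{..<N}" "top_of_set X" B] B in simp)
  moreover have "v \<in> ((\<Inter>n\<in>{..<N}. B n) \<inter> X) \<inter> V"
    using v VX \<open>0 < \<epsilon>\<close> by (auto simp: B_def)
  moreover have "dist ((f ^^ n) y) ((f ^^ n) z) < \<epsilon>"
    if "y \<in> B n" "z \<in> B n" for y z n
    using that dist_triangle_half_r[of "(f ^^ n) v" "(f ^^ n) y" \<epsilon>] by (simp add: B_def)
  ultimately show thesis
    by (intro that[of "((\<Inter>n\<in>{..<N}. B n) \<inter> X) \<inter> V"]) auto
qed

lemma Lr_set_if_Ld_set:
  assumes "tds X f" and \<epsilon>: "\<epsilon> \<in> Ld_set X f" "0 < \<epsilon>" and "\<delta> < \<epsilon> / 2"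
  shows "\<delta> \<in> Lr_set X f"
proof (rule ccontr)
  assume "\<delta> \<notin> Lr_set X f"
  then obtain x U where U: "openin (top_of_set X) U" "x \<in> U"
    and limsup: "\<And>y. y \<in> U \<Longrightarrow>
      limsup (\<lambda>n. ereal (dist ((f ^^ n) x) ((f ^^ n) y))) \<le> ereal \<delta>"
    unfolding Lr_set_def by (auto simp: not_less)
  obtain \<gamma> where \<gamma>: "\<delta> < \<gamma>" "\<gamma> < \<epsilon> / 2"
    using dense[OF \<open>\<delta> < \<epsilon> / 2\<close>] by blast
  have "U \<noteq> {}"
    using U by blast
  then obtain V N where V: "openin (top_of_set X) V" "V \<noteq> {}"
    and late: "\<And>y n. y \<in> V \<Longrightarrow> N \<le> n \<Longrightarrow> dist ((f ^^ n) x) ((f ^^ n) y) \<le> \<gamma>"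
    using uniform_shadowing_time[OF assms(1) U(1) _ limsup \<gamma>(1)] by metis
  obtain W where W: "openin (top_of_set X) W" "W \<noteq> {}" "W \<subseteq> V"
    and early: "\<And>y z n. y \<in> W \<Longrightarrow> z \<in> W \<Longrightarrow> n < N \<Longrightarrow> dist ((f ^^ n) y) ((f ^^ n) z) < \<epsilon>"
    using open_subset_small_images[OF assms(1) V \<open>0 < \<epsilon>\<close>] by metis
  obtain y z n where yz: "y \<in> W" "z \<in> W" and far: "dist ((f ^^ n) y) ((f ^^ n) z) > \<epsilon>"
    using \<epsilon>(1) W unfolding Ld_set_def by blast
  show False
  proof (cases "n < N")
    case True
    then show False
      using early[OF yz] far by fastforce
  next
    case False
    then have "dist ((f ^^ n) x) ((f ^^ n) y) \<le> \<gamma>" "dist ((f ^^ n) x) ((f ^^ n) z) \<le> \<gamma>"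
      using late yz W(3) by auto
    then show False
      using far \<gamma>(2) dist_triangle3[of "(f ^^ n) y" "(f ^^ n) z" "(f ^^ n) x"] by linarith
  qed
qed

theorem proposition2p1:
  fixes X :: "'a::metric_space set" and f :: "'a \<Rightarrow> 'a"
  assumes "tds X f" and "sensitive X f"
  shows "Ld X f \<le> 2 * Lr_sup X f"
proof -
  have upper: "\<delta> \<le> Lr_sup X f" if "\<delta> \<in> Lr_set X f" for \<delta>
    unfolding Lr_sup_def using that Lr_set_bdd_above[OF assms(1)] by (rule cSup_upper)
  have nonneg: "0 \<le> Lr_sup X f"
    by (rule dense_le) (use upper Lr_set_neg in blast)
  have "\<epsilon> \<le> 2 * Lr_sup X f" if "\<epsilon> \<in> Ld_set X f" for \<epsilon>
  proof (cases "0 < \<epsilon>")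
    case True
    have "\<epsilon> / 2 \<le> Lr_sup X f"
      by (rule dense_le) (use upper Lr_set_if_Ld_set[OF assms(1) that True] in blast)
    then show ?thesis
      by simp
  next
    case False
    then show ?thesis
      using nonneg by linarith
  qed
  moreover have "Ld_set X f \<noteq> {}"
    using Ld_set_neg[of "-1" X f] by auto
  ultimately show ?thesis
    unfolding Ld_def by (intro cSup_least)
qed

end
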